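(* There is an absolute constant $C$ such that for every finite point set $P\subset\mathbb{R}^2$ with distinct $x$-coordinates and distinct $y$-coordinates, with $m=|P|$, we have $\mathsf{IRB}_{\uparrow}(P)\le C\,m+m\cdot\mathsf{zRects}(P)$.
   Context: For a point $p$, $p.x,p.y$ are its coordinates. A z-rectangle of $P$ is a tuple $(p,q,r,s)\in P^4$ with $q.x<p.x<r.x<s.x$, $r.y<q.y<s.y<p.y$, and $P\cap([q.x,s.x]\times[r.y,p.y])=\{p,q,r,s\}$; $\mathsf{zRects}(P)$ is the number of z-rectangles of $P$. $\mathrm{rect}(p,q)$ is the smallest closed axis-aligned rectangle containing $p,q$. $\mathsf{IRB}_{\uparrow}$: sweep a horizontal line upward over the points of $P$ in increasing $y$-coordinate, maintaining a set $Q$ which initially is $P$. When the sweep reaches the point $p\in P$, for every point $q$ of $Q$ (as it stands when $p$ is reached, i.e. $P$ together with all points added at earlier sweep positions) with $q.x<p.x$, $q.y<p.y$ and $Q\cap\mathrm{rect}(p,q)=\{p,q\}$, add the upper-left corner $(q.x,p.y)$ of $\mathrm{rect}(p,q)$ to $Q$. Let $\mathrm{add}_{\uparrow}(P)$ be the set of all added points (excluding points originally in $P$) and $\mathsf{IRB}_{\uparrow}(P)=|\mathrm{add}_{\uparrow}(P)|$. *)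

theory Defs
  imports "HOL-Analysis.Analysis"
begin

type_synonym point = "real \<times> real"

definition rect :: "point \<Rightarrow> point \<Rightarrow> point set" where
  "rect p q = {min (fst p) (fst q)..max (fst p) (fst q)} \<times> {min (snd p) (snd q)..max (snd p) (snd q)}"

lemma rect_eq_hull: "rect p q = (\<lambda>R. \<exists>a b. R = cbox a b) hull {p, q}"
proof (rule hull_unique[symmetric])
  show "{p, q} \<subseteq> rect p q"
    by (auto simp: rect_def mem_Times_iff)
  show "\<exists>a b. rect p q = cbox a b"
    unfolding rect_def cbox_interval[symmetric] cbox_Pair_eq[symmetric] by blast
  show "rect p q \<subseteq> T" if pq: "{p, q} \<subseteq> T" and T: "\<exists>a b. T = cbox a b" for T
  proof -
    from T obtain a b where "T = cbox a b" by blast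
    then have "T = {fst a..fst b} \<times> {snd a..snd b}"
      by (metis cbox_Pair_eq cbox_interval prod.collapse)
    with pq show ?thesis
      by (auto simp: rect_def mem_Times_iff)
  qed
qed

definition is_zrect :: "point set \<Rightarrow> point \<times> point \<times> point \<times> point \<Rightarrow> bool" where
  "is_zrect P = (\<lambda>(p, q, r, s).
     p \<in> P \<and> q \<in> P \<and> r \<in> P \<and> s \<in> P \<and>
     fst q < fst p \<and> fst p < fst r \<and> fst r < fst s \<and>
     snd r < snd q \<and> snd q < snd s \<and> snd s < snd p \<and>
     P \<inter> ({fst q..fst s} \<times> {snd r..snd p}) = {p, q, r, s})"

definition zRects :: "point set \<Rightarrow> nat" where
  "zRects P = card {t. is_zrect P t}"

definition irb_up_step :: "point \<Rightarrow> point set \<Rightarrow> point set" where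
  "irb_up_step p Q =
     Q \<union> {(fst q, snd p) | q. q \<in> Q \<and> fst q < fst p \<and> snd q < snd p \<and> Q \<inter> rect p q = {p, q}}"

text \<open>The enumeration of \<open>P\<close> by increasing \<open>y\<close>-coordinate is only meaningful if \<open>P\<close> is finite
  and its \<open>y\<close>-coordinates are distinct.\<close>

definition irb_up_sweep :: "point set \<Rightarrow> point set" where
  "irb_up_sweep P = fold irb_up_step (sorted_key_list_of_set snd P) P"

definition add_up :: "point set \<Rightarrow> point set" where
  "add_up P = irb_up_sweep P - P"

definition IRB_up :: "point set \<Rightarrow> nat" where
  "IRB_up P = card (add_up P)"

end

theory Submission
  imports Defs
begin

text \<open>
  Let \<open>A\<close> be the final point set of the sweep. If the row of \<open>p\<close> receives a point in the column of
  \<open>l \<in> P\<close>, then all points of \<open>A\<close> below \<open>p\<close> strictly between the two columns lie below \<open>l\<close>.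
  Suppose that row \<open>p\<close> extends two columns, those of \<open>l\<close> and, to the right of it, \<open>l'\<close>, and that the
  column of \<open>l\<close> had been extended before. The earlier extension comes from a point to the right of
  \<open>p\<close> above \<open>l\<close>, whereas the nearest point to the right of \<open>p\<close> below \<open>p\<close> must lie below \<open>l\<close>: otherwise
  it would already have extended the column of \<open>l'\<close> above \<open>l\<close>. Hence \<open>p\<close> is the top of a
  z-rectangle. So every row that is not the top of a z-rectangle receives at most one point in
  a column that was extended before, and there are at most \<open>|P|\<close> first extensions.
\<close>

text \<open>The sweep condition for \<open>p\<close> and \<open>q\<close>, restricted to rows strictly below \<open>p\<close>; these rows no longer
  change once \<open>p\<close> is reached, so the condition can be read off the final point set.\<close>

definition sees :: "point set \<Rightarrow> point \<Rightarrow> point \<Rightarrow> bool" where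
  "sees A p q \<longleftrightarrow> q \<in> A \<and> fst q < fst p \<and> snd q < snd p \<and>
     (\<forall>z\<in>A. fst q \<le> fst z \<longrightarrow> fst z \<le> fst p \<longrightarrow> snd q \<le> snd z \<longrightarrow> snd z < snd p \<longrightarrow> z = q)"

section \<open>Extremal elements and sorted enumerations\<close>

lemma finite_ex_min:
  fixes f :: "'a \<Rightarrow> 'b::linorder"
  assumes "finite S" "x \<in> S"
  obtains m where "m \<in> S" "\<And>u. u \<in> S \<Longrightarrow> f m \<le> f u"
proof -
  have "Min (f ` S) \<in> f ` S" using assms by (intro Min_in) auto
  then obtain m where "m \<in> S" "f m = Min (f ` S)" by auto
  then show ?thesis using that assms by simp
qed

lemma finite_ex_max:
  fixes f :: "'a \<Rightarrow> 'b::linorder"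
  assumes "finite S" "x \<in> S"
  obtains m where "m \<in> S" "\<And>u. u \<in> S \<Longrightarrow> f u \<le> f m"
proof -
  have "Max (f ` S) \<in> f ` S" using assms by (intro Max_in) auto
  then obtain m where "m \<in> S" "f m = Max (f ` S)" by auto
  then show ?thesis using that assms by simp
qed

lemma (in linorder) set_sorted_key_list_of_finite:
  assumes "finite S" "inj_on f S"
  shows "set (sorted_key_list_of_set f S) = S"
proof -
  interpret folding_insort_key "(\<le>)" "(<)" S f by unfold_locales (rule assms)
  show ?thesis using assms by simp
qed

lemma (in linorder) strict_sorted_key_list_of_inj:
  assumes "inj_on f S"
  shows "sorted_wrt (<) (map f (sorted_key_list_of_set f S))"
proof -
  interpret folding_insort_key "(\<le>)" "(<)" S f by unfold_locales (rule assms)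
  show ?thesis by simp
qed

section \<open>Points created by a run of sweep steps\<close>

lemma fold_irb_up_step_mono: "Q \<subseteq> fold irb_up_step ps Q"
proof (induction ps arbitrary: Q)
  case (Cons p ps)
  have "Q \<subseteq> irb_up_step p Q" by (auto simp: irb_up_step_def)
  also have "\<dots> \<subseteq> fold irb_up_step ps (irb_up_step p Q)" by (rule Cons.IH)
  finally show ?case by simp
qed simp

lemma fold_irb_up_step_rows:
  "z \<in> fold irb_up_step ps Q \<Longrightarrow> z \<in> Q \<or> snd z \<in> snd ` set ps"
proof (induction ps arbitrary: Q)
  case (Cons p ps)
  then have "z \<in> irb_up_step p Q \<or> snd z \<in> snd ` set ps" by simp
  then show ?case by (auto simp: irb_up_step_def)
qed simp

lemma fold_irb_up_step_cases:
  assumes "z \<in> fold irb_up_step ps Q"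
  shows "z \<in> Q \<or> (\<exists>xs p ys. ps = xs @ p # ys \<and> z \<in> irb_up_step p (fold irb_up_step xs Q)
            \<and> z \<notin> fold irb_up_step xs Q)"
  using assms
proof (induction ps rule: rev_induct)
  case (snoc p ps)
  show ?case
  proof (cases "z \<in> fold irb_up_step ps Q")
    case True
    from snoc.IH[OF True] show ?thesis
      by (metis append.assoc append_Cons)
  next
    case False
    moreover have "z \<in> irb_up_step p (fold irb_up_step ps Q)" using snoc.prems by simp
    ultimately show ?thesis by blast
  qed
qed simp

section \<open>The sweep conditions in terms of the final point set\<close>

locale plane_points =
  fixes P :: "point set"
  assumes finite_P: "finite P" and inj_fst: "inj_on fst P" and inj_snd: "inj_on snd P"
begin

lemma fst_eqD: "p \<in> P \<Longrightarrow> q \<in> P \<Longrightarrow> fst p = fst q \<Longrightarrow> p = q"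
  using inj_fst by (auto dest: inj_onD)

lemma snd_eqD: "p \<in> P \<Longrightarrow> q \<in> P \<Longrightarrow> snd p = snd q \<Longrightarrow> p = q"
  using inj_snd by (auto dest: inj_onD)

abbreviation A :: "point set" where "A \<equiv> irb_up_sweep P"

definition ps :: "point list" where "ps = sorted_key_list_of_set snd P"

lemma set_ps: "set ps = P"
  unfolding ps_def by (rule set_sorted_key_list_of_finite[OF finite_P inj_snd])

lemma sorted_ps: "sorted_wrt (\<lambda>a b. snd a < snd b) ps"
  using strict_sorted_key_list_of_inj[OF inj_snd] by (simp add: sorted_wrt_map ps_def)

lemma sweep_eq: "A = fold irb_up_step ps P"
  by (simp add: irb_up_sweep_def ps_def)

lemma P_subset: "P \<subseteq> A"
  unfolding sweep_eq by (rule fold_irb_up_step_mono)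

lemma P_A: "p \<in> P \<Longrightarrow> p \<in> A"
  using P_subset by blast

text \<open>The steps from \<open>p\<close> on create points only at height \<open>snd p\<close> or
  more, so all lower rows are already final.\<close>

lemma state_below:
  assumes ps: "ps = xs @ p # ys" and z: "snd z < snd p"
  shows "z \<in> fold irb_up_step xs P \<longleftrightarrow> z \<in> A"
proof -
  have eq: "A = fold irb_up_step (p # ys) (fold irb_up_step xs P)"
    unfolding sweep_eq ps by simp
  have "snd p \<le> snd u" if "u \<in> set (p # ys)" for u
    using sorted_ps that by (auto simp: ps sorted_wrt_append less_imp_le)
  then have "snd z \<notin> snd ` set (p # ys)" using z by force
  then show ?thesis
    unfolding eq using fold_irb_up_step_rows[of z "p # ys"] fold_irb_up_step_mono by blast
qed

lemma state_row:
  assumes ps: "ps = xs @ p # ys" and z: "z \<in> fold irb_up_step xs P" "snd z = snd p"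
  shows "z = p"
proof -
  have "snd u < snd p" if "u \<in> set xs" for u
    using sorted_ps that by (auto simp: ps sorted_wrt_append)
  then have "snd z \<notin> snd ` set xs" using z(2) by force
  then have "z \<in> P" using fold_irb_up_step_rows[OF z(1)] by blast
  moreover have "p \<in> P" using set_ps ps by auto
  ultimately show ?thesis using z(2) by (simp add: snd_eqD)
qed

text \<open>When \<open>p\<close> is reached, the rows below it are final and its own row holds only
  \<open>p\<close>. The strict bound \<open>snd z < snd p\<close> in \<open>sees\<close> skips that
  row, where \<open>A\<close> may contain the corners that \<open>p\<close> adds.\<close>

lemma sees_iff:
  assumes ps: "ps = xs @ p # ys" and Q: "Q = fold irb_up_step xs P"
  shows "sees A p q \<longleftrightarrow> q \<in> Q \<and> fst q < fst p \<and> snd q < snd p \<and> Q \<inter> rect p q = {p, q}"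
proof -
  have p: "p \<in> Q"
    using fold_irb_up_step_mono[of P xs] set_ps ps Q by auto
  have below: "z \<in> Q \<longleftrightarrow> z \<in> A" if "snd z < snd p" for z
    using state_below[OF ps that] Q by simp
  have row: "z = p" if "z \<in> Q" "snd z = snd p" for z
    using state_row[OF ps] that Q by simp
  show ?thesis
  proof
    assume s: "sees A p q"
    have "z \<in> {p, q}" if "z \<in> Q" "z \<in> rect p q" for z
    proof (cases "snd z < snd p")
      case True
      then show ?thesis
        using s that below[OF True] by (auto simp: sees_def rect_def mem_Times_iff)
    next
      case False
      then have "snd z = snd p" using s that by (auto simp: sees_def rect_def mem_Times_iff)
      then show ?thesis using row that by blast
    qed
    then have "Q \<inter> rect p q \<subseteq> {p, q}" by blast
    moreover have "q \<in> Q" using s below by (simp add: sees_def)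
    moreover have "{p, q} \<subseteq> rect p q" by (auto simp: rect_def mem_Times_iff)
    ultimately show "q \<in> Q \<and> fst q < fst p \<and> snd q < snd p \<and> Q \<inter> rect p q = {p, q}"
      using s p unfolding sees_def by blast
  next
    assume s: "q \<in> Q \<and> fst q < fst p \<and> snd q < snd p \<and> Q \<inter> rect p q = {p, q}"
    have "z = q" if "z \<in> A" "fst q \<le> fst z" "fst z \<le> fst p" "snd q \<le> snd z" "snd z < snd p" for z
    proof -
      have "z \<in> Q \<inter> rect p q" using that below by (auto simp: rect_def mem_Times_iff)
      then show ?thesis using s that(5) by auto
    qed
    then show "sees A p q" using s below[of q] by (simp add: sees_def)
  qed
qed

lemma sees_corner:
  assumes "p \<in> P" "sees A p q"
  shows "(fst q, snd p) \<in> A"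
proof -
  obtain xs ys where ps: "ps = xs @ p # ys"
    using assms(1) set_ps by (metis split_list)
  have "(fst q, snd p) \<in> irb_up_step p (fold irb_up_step xs P)"
    using assms(2) unfolding sees_iff[OF ps refl] irb_up_step_def by blast
  then show ?thesis
    unfolding sweep_eq ps using fold_irb_up_step_mono[of "irb_up_step p _" ys] by auto
qed

lemma added_cases:
  assumes "z \<in> A" "z \<notin> P"
  obtains p q where "p \<in> P" "sees A p q" "z = (fst q, snd p)"
proof -
  from fold_irb_up_step_cases[OF assms(1)[unfolded sweep_eq]] assms(2)
  obtain xs p ys where ps: "ps = xs @ p # ys"
    and z: "z \<in> irb_up_step p (fold irb_up_step xs P)" "z \<notin> fold irb_up_step xs P"
    by blast
  from z obtain q where "z = (fst q, snd p)" "sees A p q"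
    unfolding sees_iff[OF ps refl] irb_up_step_def by blast
  moreover have "p \<in> P" using set_ps ps by auto
  ultimately show ?thesis using that by blast
qed

section \<open>The grid of rows and columns of \<open>P\<close>\<close>

lemma A_rows: "z \<in> A \<Longrightarrow> snd z \<in> snd ` P"
  by (cases "z \<in> P") (force elim: added_cases)+

lemma finite_column: "finite {z \<in> A. fst z = x}"
proof (rule finite_subset)
  show "{z \<in> A. fst z = x} \<subseteq> {x} \<times> snd ` P"
    using A_rows by (auto simp: mem_Times_iff)
qed (use finite_P in auto)

text \<open>An added point lies above the point seen in its column, so the lowest point of a column
  cannot be an added one.\<close>

lemma column_base:
  assumes "z \<in> A"
  obtains l where "l \<in> P" "fst l = fst z" "snd l \<le> snd z"
proof -
  let ?S = "{w \<in> A. fst w = fst z}"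
  have "z \<in> ?S" using assms by simp
  then obtain l where l: "l \<in> ?S" "\<And>w. w \<in> ?S \<Longrightarrow> snd l \<le> snd w"
    using finite_ex_min[OF finite_column[of "fst z"], of z snd] by blast
  have "l \<in> P"
  proof (rule ccontr)
    assume "l \<notin> P"
    with l(1) obtain p q where "sees A p q" "l = (fst q, snd p)"
      by (auto elim: added_cases)
    then show False using l(1) l(2)[of q] by (simp add: sees_def)
  qed
  then show ?thesis using that l assms by blast
qed

lemma A_columns: "z \<in> A \<Longrightarrow> fst z \<in> fst ` P"
  by (metis column_base imageI)

lemma finite_A: "finite A"
proof (rule finite_subset)
  show "A \<subseteq> fst ` P \<times> snd ` P"
    using A_rows A_columns by (auto simp: mem_Times_iff)
qed (use finite_P in auto)

section \<open>Windows and z-rectangles\<close>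

text \<open>If the highest window point \<open>v\<close> were not below \<open>l\<close>, some point
  of \<open>P\<close> lower than \<open>p\<close> would have extended the column of \<open>q\<close>
  across the height of \<open>v\<close>. It can lie neither in the window nor to the right of
  \<open>p\<close>.\<close>

lemma window_below_base:
  assumes pP: "p \<in> P" and s: "sees A p q" and l: "l \<in> P" "fst l = fst q"
    and w: "w \<in> A" "fst q < fst w" "fst w < fst p" "snd w < snd p"
  shows "snd w < snd l"
proof (rule ccontr)
  assume nless: "\<not> snd w < snd l"
  let ?W = "{w \<in> A. fst q < fst w \<and> fst w < fst p \<and> snd w < snd p}"
  have finW: "finite ?W" using finite_A by simp
  have wW: "w \<in> ?W" using w by simp
  obtain v where v: "v \<in> ?W" "\<And>u. u \<in> ?W \<Longrightarrow> snd u \<le> snd v"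
    using finite_ex_max[OF finW wW, of snd] by blast
  have lv: "snd l \<le> snd v" using nless v(2)[OF wW] by linarith
  have vq: "snd v < snd q"
  proof (rule ccontr)
    assume "\<not> snd v < snd q"
    then have "v = q" using s v(1) by (auto simp: sees_def)
    then show False using v(1) by simp
  qed
  \<comment> \<open>The first column point \<open>z\<close> above \<open>v\<close>: the point
    \<open>q'\<close> from which it arises must then be at or below \<open>v\<close>.\<close>
  let ?Z = "{z \<in> A. fst z = fst q \<and> snd v < snd z}"
  have finZ: "finite ?Z" using finite_A by simp
  have qZ: "q \<in> ?Z" using s vq by (simp add: sees_def)
  obtain z where z: "z \<in> ?Z" "\<And>u. u \<in> ?Z \<Longrightarrow> snd z \<le> snd u"
    using finite_ex_min[OF finZ qZ, of snd] by blast
  have "z \<notin> P"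
  proof
    assume "z \<in> P"
    then have "z = l" using z(1) l by (auto intro: fst_eqD)
    then show False using z(1) lv by simp
  qed
  then obtain p' q' where p': "p' \<in> P" "sees A p' q'" "z = (fst q', snd p')"
    using z(1) by (auto elim: added_cases)
  have q': "fst q' = fst q" "q' \<in> A" "snd q' < snd p'" "fst q' < fst p'"
    using p' z(1) by (auto simp: sees_def)
  have q'v: "snd q' \<le> snd v"
    using z(2)[of q'] q' p'(3) by force
  have p'p: "snd p' < snd p" using z(2)[OF qZ] p'(3) s by (simp add: sees_def)
  \<comment> \<open>To the left of \<open>p\<close>, \<open>p'\<close> would be a window point
    higher than \<open>v\<close>.\<close>
  have "fst p < fst p'"
  proof (rule ccontr)
    assume "\<not> fst p < fst p'"
    moreover have "fst p' \<noteq> fst p" using fst_eqD[OF p'(1) pP] p'p by auto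
    ultimately have "p' \<in> ?W" using p' q' p'p P_A by auto
    then show False using v(2) z(1) p'(3) by fastforce
  qed
  \<comment> \<open>The rectangle of \<open>p'\<close> and \<open>q'\<close> covers
    \<open>v\<close>, which is off the column of \<open>q'\<close>.\<close>
  then have "v = q'"
    using p'(2,3) q'(1) q'v v(1) z(1) by (auto simp: sees_def)
  then show False using q' v(1) by simp
qed

text \<open>The highest column point \<open>t\<close> below \<open>r\<close> is visible from
  \<open>r\<close>: a blocking point left of \<open>p\<close> is excluded by
  \<open>window_below_base\<close>, one right of \<open>p\<close> by the choice of \<open>r\<close>
  as nearest.\<close>

lemma neighbour_extends:
  assumes p: "p \<in> P" and s: "sees A p q" and l: "l \<in> P" "fst l = fst q"
    and r: "r \<in> P" "fst p < fst r" "snd r < snd p" "snd l < snd r"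
    and near: "\<And>u. u \<in> P \<Longrightarrow> fst p < fst u \<Longrightarrow> snd u < snd p \<Longrightarrow> fst r \<le> fst u"
  shows "(fst q, snd r) \<in> A"
proof -
  let ?Z = "{z \<in> A. fst z = fst q \<and> snd z < snd r}"
  have finZ: "finite ?Z" using finite_A by simp
  have lZ: "l \<in> ?Z" using l r P_A by simp
  obtain t where t: "t \<in> ?Z" "\<And>u. u \<in> ?Z \<Longrightarrow> snd u \<le> snd t"
    using finite_ex_max[OF finZ lZ, of snd] by blast
  have "z = t"
    if z: "z \<in> A" "fst t \<le> fst z" "fst z \<le> fst r" "snd t \<le> snd z" "snd z < snd r" for z
  proof -
    \<comment> \<open>Since \<open>near\<close> concerns \<open>P\<close> only, it is applied to the
      base \<open>u\<close> of the column of \<open>z\<close>.\<close>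
    obtain u where u: "u \<in> P" "fst u = fst z" "snd u \<le> snd z"
      using column_base[OF z(1)] by blast
    have "fst u < fst p"
    proof (rule ccontr)
      assume "\<not> fst u < fst p"
      moreover have "fst u \<noteq> fst p" using fst_eqD[OF u(1) p] u z r by auto
      ultimately have "fst r \<le> fst u" using near[OF u(1)] u z r by auto
      then have "u = r" using fst_eqD[OF u(1) r(1)] u z by auto
      then show False using u z by simp
    qed
    then have "\<not> fst q < fst z"
      using window_below_base[OF p s l z(1)] u(2) z r(3) t(2)[OF lZ] by auto
    then have "fst z = fst t" using z t by auto
    moreover from this have "snd z \<le> snd t" using t z by auto
    ultimately show ?thesis using z by (auto simp: prod_eq_iff)
  qed
  then have "sees A r t"
    using t(1) s r by (auto simp: sees_def)
  then show ?thesis using sees_corner[OF r(1), of t] t(1) by simp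
qed

text \<open>The corners are chosen extremally in the order \<open>s\<close>, \<open>r\<close>,
  \<open>q\<close>, with \<open>b\<close>, \<open>a\<close>, \<open>l\<close> as witnesses that
  candidates exist; extremality empties the rectangle.\<close>

lemma zrect_exists:
  assumes p: "p \<in> P" and l: "l \<in> P" "fst l < fst p" "snd l < snd p"
    and window: "\<And>u. u \<in> P \<Longrightarrow> fst l < fst u \<Longrightarrow> fst u < fst p \<Longrightarrow> snd u < snd p \<Longrightarrow> snd u < snd l"
    and a: "a \<in> P" "fst p < fst a" "snd a < snd l"
    and b: "b \<in> P" "fst a \<le> fst b" "snd l < snd b" "snd b < snd p"
    and near: "\<And>u. u \<in> P \<Longrightarrow> fst p < fst u \<Longrightarrow> snd u < snd p \<Longrightarrow> fst a \<le> fst u"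
  shows "\<exists>q r s. is_zrect P (p, q, r, s)"
proof -
  let ?S = "{u \<in> P. fst p < fst u \<and> snd l < snd u \<and> snd u < snd p}"
  have S: "finite ?S" "b \<in> ?S" using finite_P a b by auto
  obtain s where s: "s \<in> ?S" "\<And>u. u \<in> ?S \<Longrightarrow> fst s \<le> fst u"
    using finite_ex_min[OF S(1) S(2), of fst] by blast
  have "a \<noteq> s" using a s(1) by auto
  then have as: "fst a < fst s"
    using near[of s] s(1) fst_eqD[of a s] a(1) by force
  let ?R = "{u \<in> P. fst p < fst u \<and> fst u < fst s \<and> snd u < snd p}"
  have R: "finite ?R" "a \<in> ?R" using finite_P a l as by auto
  obtain r where r: "r \<in> ?R" "\<And>u. u \<in> ?R \<Longrightarrow> snd u \<le> snd r"
    using finite_ex_max[OF R(1) R(2), of snd] by blast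
  have "r \<noteq> l" using r(1) l by auto
  \<comment> \<open>A higher \<open>r\<close> would be a candidate for \<open>s\<close> further to
    the left.\<close>
  then have rl: "snd r < snd l"
    using s(2)[of r] r(1) snd_eqD[of r l] l(1) by force
  let ?Q = "{u \<in> P. fst l \<le> fst u \<and> fst u < fst p \<and> snd r < snd u \<and> snd u < snd p}"
  have Q: "finite ?Q" "l \<in> ?Q" using finite_P l rl by auto
  obtain q where q: "q \<in> ?Q" "\<And>u. u \<in> ?Q \<Longrightarrow> fst u \<le> fst q"
    using finite_ex_max[OF Q(1) Q(2), of fst] by blast
  have ql: "snd q \<le> snd l"
    using window[of q] q(1) fst_eqD[of q l] l(1) by force
  have "u \<in> {p, q, r, s}"
    if u: "u \<in> P" "fst q \<le> fst u" "fst u \<le> fst s" "snd r \<le> snd u" "snd u \<le> snd p" for u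
  proof (cases "u = p \<or> u = s \<or> u = r")
    case False
    then have ne: "fst u \<noteq> fst p" "fst u \<noteq> fst s" "snd u \<noteq> snd p" "snd u \<noteq> snd r"
      using fst_eqD[OF u(1) p] fst_eqD[OF u(1), of s] snd_eqD[OF u(1) p] snd_eqD[OF u(1), of r]
        s(1) r(1) by blast+
    \<comment> \<open>To the right of \<open>p\<close>, \<open>u\<close> would contradict the
      maximality of \<open>r\<close>; to the left, the choice of \<open>q\<close> forces it into the
      column of \<open>q\<close>.\<close>
    have "fst u < fst p" using r(2)[of u] u ne by force
    then have "fst u \<le> fst q" using q u ne by auto
    then show ?thesis using fst_eqD[of u q] u q(1) by auto
  qed auto
  then have "P \<inter> ({fst q..fst s} \<times> {snd r..snd p}) \<subseteq> {p, q, r, s}"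
    unfolding mem_Times_iff subset_iff by simp
  moreover have "{p, q, r, s} \<subseteq> P \<inter> ({fst q..fst s} \<times> {snd r..snd p})"
    using p q(1) r(1) s(1) ql rl by (simp add: mem_Times_iff)
  ultimately have "P \<inter> ({fst q..fst s} \<times> {snd r..snd p}) = {p, q, r, s}"
    by (rule equalityI)
  then have "is_zrect P (p, q, r, s)"
    using p q(1) r(1) s(1) ql rl by (auto simp: is_zrect_def)
  then show ?thesis by blast
qed

text \<open>Added points that are not repeated are charged to their column, the others to their
  row.\<close>

definition repeated :: "point \<Rightarrow> bool" where
  "repeated z \<longleftrightarrow> (\<exists>w\<in>A - P. fst w = fst z \<and> snd w < snd z)"

lemma repeated_zrect:
  assumes p: "p \<in> P" and s: "sees A p q" and s': "sees A p q'" and lt: "fst q < fst q'"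
    and rep: "repeated (fst q, snd p)"
  shows "\<exists>q r s. is_zrect P (p, q, r, s)"
proof -
  obtain l where l: "l \<in> P" "fst l = fst q" "snd l \<le> snd q"
    using s column_base[of q] by (auto simp: sees_def)
  obtain l' where l': "l' \<in> P" "fst l' = fst q'" "snd l' \<le> snd q'"
    using s' column_base[of q'] by (auto simp: sees_def)
  note K = window_below_base[OF p s l(1,2)]
  have l'l: "snd l' < snd l"
    using K[of l'] l' lt s' P_A by (auto simp: sees_def)
  obtain w where w: "w \<in> A" "w \<notin> P" "fst w = fst q" "snd w < snd p"
    using rep by (auto simp: repeated_def)
  obtain b t where b: "b \<in> P" "sees A b t" "w = (fst t, snd b)"
    using added_cases[OF w(1,2)] by blast
  obtain l2 where l2: "l2 \<in> P" "fst l2 = fst t" "snd l2 \<le> snd t"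
    using b(2) column_base[of t] by (auto simp: sees_def)
  \<comment> \<open>A column has only one point of \<open>P\<close>, so \<open>b\<close> is above
    \<open>l\<close>, and \<open>K\<close> then keeps it out of the window.\<close>
  have "l2 = l" using fst_eqD[of l2 l] l l2 w b(3) by auto
  then have bl: "snd l < snd b" using l2 b(2) by (auto simp: sees_def)
  have tb: "fst q < fst b" "snd b < snd p" using b w by (auto simp: sees_def)
  have "\<not> fst b < fst p" using K[OF P_A[OF b(1)]] tb bl by auto
  moreover have "fst b \<noteq> fst p" using fst_eqD[OF b(1) p] tb by auto
  ultimately have pb: "fst p < fst b" by simp
  let ?S = "{u \<in> P. fst p < fst u \<and> snd u < snd p}"
  have S: "finite ?S" "b \<in> ?S" using finite_P b pb tb by auto
  obtain a where a: "a \<in> ?S" "\<And>u. u \<in> ?S \<Longrightarrow> fst a \<le> fst u"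
    using finite_ex_min[OF S(1) S(2), of fst] by blast
  have "\<not> snd l < snd a"
  proof
    assume la: "snd l < snd a"
    \<comment> \<open>Being above \<open>l\<close>, \<open>a\<close> is above \<open>l'\<close> too
      and extends the column of \<open>q'\<close>. That column runs through the window of
      \<open>q\<close>, whose points stay below \<open>l\<close>.\<close>
    then have "(fst q', snd a) \<in> A"
      using neighbour_extends[OF p s' l'(1,2), of a] a l'l by auto
    then show False using K[of "(fst q', snd a)"] la a(1) lt s' by (auto simp: sees_def)
  qed
  moreover have "a \<noteq> l" using a(1) l s by (auto simp: sees_def)
  ultimately have al: "snd a < snd l" using snd_eqD[of a l] a(1) l(1) by force
  show ?thesis
  proof (rule zrect_exists[OF p l(1), of a b])
    show "snd u < snd l" if "u \<in> P" "fst l < fst u" "fst u < fst p" "snd u < snd p" for u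
      using K[OF P_A[OF that(1)]] that l by simp
  qed (use a b bl tb pb al l s S in \<open>auto simp: sees_def\<close>)
qed

section \<open>Counting the added points\<close>

definition tops :: "point set" where
  "tops = {p. \<exists>q r s. is_zrect P (p, q, r, s)}"

lemma tops_subset: "tops \<subseteq> P"
  by (auto simp: tops_def is_zrect_def)

lemma card_tops: "card tops \<le> zRects P"
proof -
  have "{t. is_zrect P t} \<subseteq> P \<times> P \<times> P \<times> P" by (auto simp: is_zrect_def)
  then have fin: "finite {t. is_zrect P t}" by (rule finite_subset) (use finite_P in simp)
  have "tops \<subseteq> fst ` {t. is_zrect P t}" by (force simp: tops_def)
  then have "card tops \<le> card (fst ` {t. is_zrect P t})" using fin by (intro card_mono) auto
  also have "\<dots> \<le> zRects P" unfolding zRects_def by (rule card_image_le[OF fin])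
  finally show ?thesis .
qed

text \<open>Each point counted is the lowest added point of its column, so columns index these
  points injectively.\<close>

lemma card_first: "card {z \<in> A - P. \<not> repeated z} \<le> card P"
proof -
  have "inj_on fst {z \<in> A - P. \<not> repeated z}"
  proof (rule inj_onI)
    fix z w assume "z \<in> {z \<in> A - P. \<not> repeated z}" "w \<in> {z \<in> A - P. \<not> repeated z}" "fst z = fst w"
    then show "z = w"
      unfolding repeated_def by (metis (mono_tags, lifting) linorder_neqE mem_Collect_eq prod_eqI)
  qed
  moreover have "fst ` {z \<in> A - P. \<not> repeated z} \<subseteq> fst ` P" using A_columns by auto
  ultimately have "card {z \<in> A - P. \<not> repeated z} \<le> card (fst ` P)"
    using finite_P by (intro card_inj_on_le) auto
  also have "\<dots> \<le> card P" by (rule card_image_le[OF finite_P])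
  finally show ?thesis .
qed

text \<open>The row of a top is bounded by the number of columns. In any other row, the left one of
  two such points would make \<open>p\<close> a top by \<open>repeated_zrect\<close>.\<close>

lemma card_repeated_row:
  assumes p: "p \<in> P"
  shows "card {z \<in> A - P. repeated z \<and> snd z = snd p} \<le> 1 + (if p \<in> tops then card P else 0)"
    (is "card ?N \<le> _")
proof (cases "p \<in> tops")
  case True
  have "inj_on fst ?N" by (auto intro!: inj_onI prod_eqI)
  moreover have "fst ` ?N \<subseteq> fst ` P" using A_columns by auto
  ultimately have "card ?N \<le> card (fst ` P)" using finite_P by (intro card_inj_on_le) auto
  also have "\<dots> \<le> card P" by (rule card_image_le[OF finite_P])
  finally show ?thesis using True by simp
next
  case False
  have sees: "\<exists>q. sees A p q \<and> z = (fst q, snd p)" if "z \<in> ?N" for z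
  proof -
    have z: "z \<in> A" "z \<notin> P" "snd z = snd p" using that by auto
    obtain p' q where "p' \<in> P" "sees A p' q" "z = (fst q, snd p')"
      using added_cases[OF z(1,2)] by blast
    then show ?thesis using snd_eqD[of p' p] p z(3) by (metis snd_conv)
  qed
  have no: "\<not> fst z < fst w" if zw: "z \<in> ?N" "w \<in> ?N" for z w
  proof
    assume "fst z < fst w"
    moreover obtain q q' where "sees A p q" "z = (fst q, snd p)" "sees A p q'" "w = (fst q', snd p)"
      using sees[OF zw(1)] sees[OF zw(2)] by blast
    ultimately have "p \<in> tops"
      unfolding tops_def using repeated_zrect[OF p, of q q'] zw(1) by auto
    then show False using False by simp
  qed
  have "z = w" if zw: "z \<in> ?N" "w \<in> ?N" for z w
    using no[OF zw] no[OF zw(2,1)] zw by (auto intro: prod_eqI)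
  then have "card ?N \<le> 1"
    using finite_A by (subst One_nat_def, subst card_le_Suc0_iff_eq) auto
  then show ?thesis using False by simp
qed

theorem IRB_up_le: "IRB_up P \<le> 2 * card P + card P * zRects P"
proof -
  let ?F = "{z \<in> A - P. \<not> repeated z}"
  let ?N = "\<lambda>p. {z \<in> A - P. repeated z \<and> snd z = snd p}"
  have "A - P \<subseteq> ?F \<union> (\<Union>p\<in>P. ?N p)" using A_rows by fastforce
  then have "card (A - P) \<le> card (?F \<union> (\<Union>p\<in>P. ?N p))"
    using finite_A finite_P by (intro card_mono) auto
  also have "\<dots> \<le> card ?F + card (\<Union>p\<in>P. ?N p)" by (rule card_Un_le)
  also have "\<dots> \<le> card P + (\<Sum>p\<in>P. card (?N p))"
    by (intro add_mono card_first card_UN_le finite_P)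
  also have "\<dots> \<le> card P + (\<Sum>p\<in>P. 1 + (if p \<in> tops then card P else 0))"
    by (intro add_left_mono sum_mono card_repeated_row)
  \<comment> \<open>The constant 2 arises from one \<open>card P\<close> for the first extensions
    and one for the summand 1 of each row.\<close>
  also have "(\<Sum>p\<in>P. 1 + (if p \<in> tops then card P else 0)) = card P + card P * card tops"
    using tops_subset finite_P
    by (simp only: sum.distrib sum.inter_restrict[symmetric])
       (simp add: Int_absorb1 mult.commute)
  also have "card P + (card P + card P * card tops) \<le> 2 * card P + card P * zRects P"
    using mult_le_mono2[OF card_tops, of "card P"] by simp
  finally show ?thesis by (simp add: IRB_up_def add_up_def)
qed

end

theorem theorem30:
  shows "\<exists>C::real. \<forall>P::(real \<times> real) set.
    finite P \<longrightarrow> inj_on fst P \<longrightarrow> inj_on snd P \<longrightarrow>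
    real (IRB_up P) \<le> C * real (card P) + real (card P) * real (zRects P)"
proof (intro exI allI impI)
  fix P :: "(real \<times> real) set"
  assume "finite P" "inj_on fst P" "inj_on snd P"
  then interpret plane_points P by unfold_locales
  have "real (IRB_up P) \<le> real (2 * card P + card P * zRects P)"
    using IRB_up_le by (simp only: of_nat_le_iff)
  then show "real (IRB_up P) \<le> 2 * real (card P) + real (card P) * real (zRects P)" by simp
qed

end
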